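(* For $R=\mathbb{Z}_{25}$ and for $R=\mathbb{S}_5=\mathbb{F}_5[X]/(X^2)$ there exist projective arcs with parameters $(425,18)$ and $(455,19)$ in $\mathrm{PHG}(2,R)$.
   Context: For a finite chain ring $R$ of length $2$ with residue field $\mathbb{F}_q$, the projective Hjelmslev plane $\mathrm{PHG}(2,R)$ is the incidence structure whose points are the free rank-$1$ submodules of the right module $R_R^3$, whose lines are the free rank-$2$ submodules of $R_R^3$, with incidence given by inclusion. A projective $(k,n)$-arc is a set of $k$ points meeting every line in at most $n$ points. *)

theory Defs
  imports Main "HOL-Library.Numeral_Type"
begin

text \<open>Dual a b represents a + b X in A[X]/(X^2).\<close>

datatype 'a dual = Dual 'a 'a

fun dre :: "'a dual \<Rightarrow> 'a" where "dre (Dual a b) = a"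
fun dep :: "'a dual \<Rightarrow> 'a" where "dep (Dual a b) = b"

lemma dual_eq_iff: "x = y \<longleftrightarrow> dre x = dre y \<and> dep x = dep y"
  by (cases x; cases y) auto

instantiation dual :: (comm_ring_1) comm_ring_1
begin
definition "0 = Dual 0 0"
definition "1 = Dual 1 0"
definition "x + y = Dual (dre x + dre y) (dep x + dep y)"
definition "x - y = Dual (dre x - dre y) (dep x - dep y)"
definition "- x = Dual (- dre x) (- dep x)"
definition "x * y = Dual (dre x * dre y) (dre x * dep y + dep x * dre y)"
instance
  by standard (simp_all add: dual_eq_iff zero_dual_def one_dual_def plus_dual_def
      minus_dual_def uminus_dual_def times_dual_def algebra_simps)
end

text \<open>S_5 = F_5[X]/(X^2); the type 5 is the field Z/5Z = F_5.
      Z_25 is the type 25 (integers modulo 25).\<close>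
type_synonym S5 = "5 dual"
type_synonym Z25 = "25"

type_synonym 'a vec3 = "'a \<times> 'a \<times> 'a"

definition vadd :: "'a::comm_ring_1 vec3 \<Rightarrow> 'a vec3 \<Rightarrow> 'a vec3" where
  "vadd x y = (fst x + fst y, fst (snd x) + fst (snd y), snd (snd x) + snd (snd y))"

definition smul :: "'a::comm_ring_1 vec3 \<Rightarrow> 'a \<Rightarrow> 'a vec3" where
  "smul x r = (fst x * r, fst (snd x) * r, snd (snd x) * r)"

text \<open>Points: free rank-1 submodules of R^3, i.e. submodules x R with basis {x}.\<close>
definition phg_point :: "'a::comm_ring_1 vec3 set \<Rightarrow> bool" where
  "phg_point S \<longleftrightarrow> (\<exists>x. S = range (smul x) \<and> inj (smul x))"

text \<open>Lines: free rank-2 submodules of R^3, i.e. submodules x R + y R with basis {x, y}.\<close>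
definition phg_line :: "'a::comm_ring_1 vec3 set \<Rightarrow> bool" where
  "phg_line S \<longleftrightarrow> (\<exists>x y. S = range (\<lambda>(a, b). vadd (smul x a) (smul y b)) \<and>
       inj (\<lambda>(a, b). vadd (smul x a) (smul y b)))"

definition proj_arc :: "'a::comm_ring_1 vec3 set set \<Rightarrow> nat \<Rightarrow> nat \<Rightarrow> bool" where
  "proj_arc K k n \<longleftrightarrow> finite K \<and> card K = k \<and> (\<forall>P\<in>K. phg_point P) \<and>
     (\<forall>L. phg_line L \<longrightarrow> card {P \<in> K. P \<subseteq> L} \<le> n)"

end

theory Submission
  imports Defs
begin

text \<open>
  Over a chain ring \<open>R\<close> of length 2 with residue field \<open>F\<^sub>5\<close> and maximal ideal \<open>\<theta>R\<close>, the points of the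
  plane fall into 31 neighbour classes, one for each point \<open>c\<close> of \<open>PG(2,5)\<close>, and each class is an affine
  plane of order 5 whose parallel classes of lines (segments) correspond to the lines of \<open>PG(2,5)\<close>
  through \<open>c\<close>. If the arc meets a class in \<open>s\<close> parallel segments, then a line over \<open>l \<ni> c\<close> meets that part
  in \<open>s\<close> points, or in 0 or 5 points if \<open>l\<close> is the direction of the segments.

  Take a triangle in \<open>PG(2,5)\<close>. Use 4 segments in each of the 16 classes off the triangle, with
  directions that form a bijection onto the 16 lines through no vertex, 2 segments along the side in
  each of the 12 remaining non-vertex classes, and one segment along a side in each vertex. A line through no
  vertex gets at most \<open>5 + 4 + 4 + 2 + 2 + 2 = 19\<close> points, a line through one vertex at most
  \<open>4 \<cdot> 4 + 2 + 1 = 19\<close>. A line over a side meets at most 3 of the segments along it if these are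
  placed like the points of a (9,3)-arc of the affine plane of order 5, whence at most 16 points.
  The total is \<open>16 \<cdot> 20 + 12 \<cdot> 10 + 3 \<cdot> 5 = 455\<close>. Dropping two vertices and one of the two segments in the
  classes of the side joining them gives the (425,18)-arc.
\<close>

section \<open>Combinatorial data over the residue field\<close>

definition dot :: "'a::comm_ring_1 vec3 \<Rightarrow> 'a vec3 \<Rightarrow> 'a" where
  "dot u v = fst u * fst v + fst (snd u) * fst (snd v) + snd (snd u) * snd (snd v)"

definition digits :: "int list" where
  "digits = [0, 1, 2, 3, 4]"

definition cube :: "int vec3 list" where
  "cube = [(x, y, z). x \<leftarrow> digits, y \<leftarrow> digits, z \<leftarrow> digits]"

text \<open>
  A cell \<open>(c, d, W)\<close> stands for the points \<open>c + \<theta>e\<close> of the neighbour class of \<open>c\<close> with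
  \<open>d \<bullet> e mod 5 \<in> W\<close>: one segment for each element of \<open>W\<close>, in the direction of the line with
  coordinates \<open>d\<close>. The pivot of \<open>c\<close> is its first nonzero coordinate, which is 1, and \<open>e\<close> vanishes there.
\<close>

type_synonym cell = "int vec3 \<times> int vec3 \<times> int list"

fun tangent :: "int vec3 \<Rightarrow> int vec3 list" where
  "tangent (x, y, z) =
    (if x = 1 then [(0, p, q). p \<leftarrow> digits, q \<leftarrow> digits]
     else if y = 1 then [(p, 0, q). p \<leftarrow> digits, q \<leftarrow> digits]
     else [(p, q, 0). p \<leftarrow> digits, q \<leftarrow> digits])"

fun segments :: "cell \<Rightarrow> int vec3 list" where
  "segments (c, d, W) = filter (\<lambda>e. dot d e mod 5 \<in> set W) (tangent c)"

definition cell_points :: "cell \<Rightarrow> (int vec3 \<times> int vec3) list" where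
  "cell_points C = map (Pair (fst C)) (segments C)"

definition points :: "cell list \<Rightarrow> (int vec3 \<times> int vec3) list" where
  "points Cs = concat (map cell_points Cs)"

fun normal :: "int vec3 \<times> int vec3 \<Rightarrow> bool" where
  "normal ((x, y, z), (p, q, r)) \<longleftrightarrow>
    list_all (\<lambda>t. t \<in> set digits) [x, y, z, p, q, r] \<and>
    (x = 1 \<and> p = 0 \<or> x = 0 \<and> y = 1 \<and> q = 0 \<or> x = 0 \<and> y = 0 \<and> z = 1 \<and> r = 0)"

definition hits :: "int vec3 \<Rightarrow> int \<Rightarrow> int vec3 list \<Rightarrow> nat" where
  "hits a k es = length (filter (\<lambda>e. (k + dot a e) mod 5 = 0) es)"

definition profile :: "int vec3 \<Rightarrow> cell list \<Rightarrow> (int vec3 \<times> nat list) list" where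
  "profile a Cs = map (\<lambda>C. (fst C, map (\<lambda>k. hits a k (segments C)) digits))
     (filter (\<lambda>C. dot a (fst C) mod 5 = 0) Cs)"

definition uniform_bound :: "nat \<Rightarrow> (int vec3 \<times> nat list) list \<Rightarrow> bool" where
  "uniform_bound n T \<longleftrightarrow> sum_list (map (\<lambda>(c, h). fold max h 0) T) \<le> n"

definition exact_bound :: "nat \<Rightarrow> (int vec3 \<times> nat list) list \<Rightarrow> bool" where
  "exact_bound n T \<longleftrightarrow>
     list_all (\<lambda>b. sum_list (map (\<lambda>(c, h). h ! nat (dot b c mod 5)) T) \<le> n) cube"

text \<open>All scalar multiples are listed because the vector annihilating a line is not
  normalised.\<close>

definition sides :: "int vec3 list" where
  "sides = concat (map (\<lambda>k. [(k, 0, 0), (0, k, 0), (0, 0, k)]) [1, 2, 3, 4])"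

definition transversals :: "int vec3 list" where
  "transversals = filter (\<lambda>a. a \<noteq> (0, 0, 0) \<and> a \<notin> set sides) cube"

text \<open>
  How a line over \<open>a\<close> is placed inside the classes depends on the carries of \<open>R\<close>. For a transversal
  the worst placement in every class is good enough. On the sides no carries occur,
  because \<open>dot a c mod 5 = 0\<close> forces \<open>dot a c = 0\<close> there, so all placements can be listed.
\<close>

definition arc_certificate :: "nat \<Rightarrow> cell list \<Rightarrow> bool" where
  "arc_certificate n Cs \<longleftrightarrow>
     distinct (map fst Cs) \<and> list_all normal (points Cs) \<and>
     list_all (\<lambda>a. uniform_bound n (profile a Cs)) transversals \<and>
     list_all (\<lambda>a. list_all (\<lambda>C. dot a (fst C) mod 5 = 0 \<longrightarrow> dot a (fst C) = 0) Cs) sides \<and>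
     list_all (\<lambda>a. exact_bound n (profile a Cs)) sides"

lemma hits_mod: "hits a (k mod 5) es = hits a k es"
  by (simp add: hits_def mod_add_left_eq)

lemma mod_5_in_digits: "(k::int) mod 5 \<in> set digits"
  using pos_mod_bound[of 5 k] pos_mod_sign[of 5 k] by (auto simp: digits_def)

lemma member_le_fold_max:
  fixes x :: nat
  assumes "x \<in> set xs"
  shows "x \<le> fold max xs m"
proof -
  have ge: "y \<le> fold max ys y" for ys and y :: nat
    by (induction ys arbitrary: y) (auto intro: order_trans[OF max.cobounded2])
  show ?thesis
    using assms
    by (induction xs arbitrary: m) (auto intro: order_trans[OF max.cobounded1 ge])
qed

lemma hits_le_max: "hits a k es \<le> fold max (map (\<lambda>k. hits a k es) digits) 0"
  by (rule member_le_fold_max) (metis (no_types, lifting) hits_mod image_eqI list.set_map mod_5_in_digits)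

lemma nth_digits_mod: "map f digits ! nat ((k::int) mod 5) = f (k mod 5)"
  using mod_5_in_digits[of k] by (auto simp: digits_def eval_nat_numeral)

lemma distinct_tangent: "distinct (tangent c)"
  by (cases c rule: tangent.cases) (simp add: digits_def)

lemma distinct_points:
  assumes "distinct (map fst Cs)"
  shows "distinct (points Cs)"
  using assms
proof (induction Cs)
  case Nil
  show ?case by (simp add: points_def)
next
  case (Cons C Cs)
  have "distinct (segments C)"
    by (cases C rule: segments.cases) (simp add: distinct_tangent)
  then have "distinct (cell_points C)"
    by (simp add: cell_points_def distinct_map inj_on_def)
  moreover have "set (cell_points C) \<inter> set (points Cs) = {}"
  proof -
    have fst_cell: "fst p = fst D" if "p \<in> set (cell_points D)" for p D
      using that by (auto simp: cell_points_def)
    have "fst p \<in> fst ` set Cs" if p: "p \<in> set (points Cs)" for p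
    proof -
      obtain D where "D \<in> set Cs" "p \<in> set (cell_points D)"
        using p unfolding points_def set_concat set_map by blast
      then show ?thesis
        using fst_cell[of p D] by simp
    qed
    moreover have "fst C \<notin> fst ` set Cs"
      using Cons.prems by simp
    ultimately show ?thesis
      using fst_cell by (metis disjoint_iff)
  qed
  ultimately show ?case
    using Cons by (simp add: points_def)
qed

lemma length_filter_points:
  "length (filter (\<lambda>(c, e). 5 dvd dot a c \<and> 5 dvd \<kappa> c + dot a e) (points Cs)) =
    sum_list (map (\<lambda>C. hits a (\<kappa> (fst C)) (segments C)) (filter (\<lambda>C. dot a (fst C) mod 5 = 0) Cs))"
proof (induction Cs)
  case Nil
  show ?case by (simp add: points_def)
next
  case (Cons C Cs)
  have "length (filter (\<lambda>(c, e). 5 dvd dot a c \<and> 5 dvd \<kappa> c + dot a e) (cell_points C)) =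
      (if dot a (fst C) mod 5 = 0 then hits a (\<kappa> (fst C)) (segments C) else 0)"
    by (simp add: cell_points_def hits_def filter_map comp_def dvd_eq_mod_eq_0)
  then show ?case
    using Cons.IH by (simp add: points_def)
qed

lemma certificate_bound:
  assumes cert: "arc_certificate n Cs"
    and a: "a \<in> set cube" "a \<noteq> (0, 0, 0)" and b: "b \<in> set cube"
  shows "length (filter (\<lambda>(c, e). 5 dvd dot a c \<and>
      5 dvd (\<epsilon> * (dot a c div 5) + dot b c) + dot a e) (points Cs)) \<le> n"
proof -
  let ?\<kappa> = "\<lambda>c. \<epsilon> * (dot a c div 5) + dot b c"
  let ?F = "filter (\<lambda>C. dot a (fst C) mod 5 = 0) Cs"
  have "sum_list (map (\<lambda>C. hits a (?\<kappa> (fst C)) (segments C)) ?F) \<le> n"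
  proof (cases "a \<in> set sides")
    case True
    have "\<forall>a\<in>set sides. \<forall>C\<in>set Cs. dot a (fst C) mod 5 = 0 \<longrightarrow> dot a (fst C) = 0"
      using cert unfolding arc_certificate_def list_all_iff by (elim conjE)
    note no_carry = bspec[OF this True]
    have "hits a (?\<kappa> (fst C)) (segments C) =
        map (\<lambda>k. hits a k (segments C)) digits ! nat (dot b (fst C) mod 5)" if "C \<in> set ?F" for C
    proof -
      have "C \<in> set Cs" and "dot a (fst C) mod 5 = 0"
        using that by simp_all
      then have "dot a (fst C) = 0"
        by (rule bspec[OF no_carry, THEN mp])
      then show ?thesis
        unfolding nth_digits_mod hits_mod by simp
    qed
    then have "sum_list (map (\<lambda>C. hits a (?\<kappa> (fst C)) (segments C)) ?F) =
        sum_list (map (\<lambda>(c, h). h ! nat (dot b c mod 5)) (profile a Cs))"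
      unfolding profile_def map_map comp_def prod.case
      by (intro arg_cong[where f = sum_list] map_cong refl)
    also have "\<dots> \<le> n"
      using cert True b unfolding arc_certificate_def exact_bound_def list_all_iff by blast
    finally show ?thesis .
  next
    case False
    then have "a \<in> set transversals"
      using a by (simp add: transversals_def)
    then have "sum_list (map (\<lambda>(c, h). fold max h 0) (profile a Cs)) \<le> n"
      using cert unfolding arc_certificate_def uniform_bound_def list_all_iff by blast
    moreover have "sum_list (map (\<lambda>C. hits a (?\<kappa> (fst C)) (segments C)) ?F) \<le>
        sum_list (map (\<lambda>(c, h). fold max h 0) (profile a Cs))"
      unfolding profile_def map_map comp_def by (simp add: sum_list_mono hits_le_max)
    ultimately show ?thesis by linarith
  qed
  then show ?thesis
    by (simp only: length_filter_points)
qed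

section \<open>Lifting to chain rings\<close>

text \<open>\<open>\<epsilon>\<close> records the carry: 1 in Z_25 with \<open>\<theta> = 5\<close>,
  and 0 in S_5, where \<open>5 = 0\<close>.\<close>

locale chain_ring_5 =
  fixes \<theta> :: "'a::comm_ring_1" and \<epsilon> :: int
  assumes expansion: "\<exists>a\<in>set digits. \<exists>b\<in>set digits. r = of_int a + \<theta> * of_int b"
    and theta_square: "\<theta> * \<theta> = 0"
    and theta_of_int_eq_0D: "\<theta> * of_int k = 0 \<Longrightarrow> 5 dvd k"
    and five_eq: "5 = \<theta> * of_int \<epsilon>"
begin

definition lift :: "int vec3 \<times> int vec3 \<Rightarrow> 'a vec3" where
  "lift = (\<lambda>((x, y, z), (p, q, r)).
     (of_int x + \<theta> * of_int p, of_int y + \<theta> * of_int q, of_int z + \<theta> * of_int r))"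

lemma theta_nonzero: "\<theta> \<noteq> 0"
  using theta_of_int_eq_0D[of 1] by auto

lemma theta_theta_mult: "\<theta> * (\<theta> * x) = 0"
  by (simp add: mult.assoc[symmetric] theta_square)

lemma one_neq_theta_mult: "\<theta> * x \<noteq> 1"
  using theta_theta_mult[of x] theta_nonzero by fastforce

lemma of_int_theta_eq_0D:
  assumes "of_int m + \<theta> * of_int k = 0"
  shows "5 dvd m" "5 dvd \<epsilon> * (m div 5) + k"
proof -
  have "\<theta> * of_int m = \<theta> * (of_int m + \<theta> * of_int k)"
    by (simp add: distrib_left theta_theta_mult)
  then show m: "5 dvd m"
    using assms by (simp add: theta_of_int_eq_0D)
  then have "(of_int m :: 'a) = of_int (5 * (m div 5))"
    by simp
  also have "\<dots> = 5 * of_int (m div 5)"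
    by (simp only: of_int_mult of_int_numeral)
  also have "\<dots> = \<theta> * of_int (\<epsilon> * (m div 5))"
    by (simp add: five_eq mult.assoc)
  finally have "\<theta> * of_int (\<epsilon> * (m div 5) + k) = of_int m + \<theta> * of_int k"
    by (simp add: distrib_left)
  then show "5 dvd \<epsilon> * (m div 5) + k"
    using assms by (metis theta_of_int_eq_0D)
qed

lemma expansion_unique:
  assumes eq: "of_int x + \<theta> * of_int p = of_int x' + \<theta> * of_int p'"
    and digits: "x \<in> set digits" "p \<in> set digits" "x' \<in> set digits" "p' \<in> set digits"
  shows "x = x' \<and> p = p'"
proof -
  have 0: "of_int (x - x') + \<theta> * of_int (p - p') = 0"
    using eq by (simp add: algebra_simps)
  have "5 dvd x - x'"
    by (rule of_int_theta_eq_0D[OF 0])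
  then have x: "x = x'"
    using digits by (auto simp: digits_def)
  then have "5 dvd p - p'"
    using of_int_theta_eq_0D(2)[OF 0] by simp
  then show ?thesis
    using x digits by (auto simp: digits_def)
qed

lemma dot_lift:
  "dot (lift (a, b)) (lift (c, e)) = of_int (dot a c) + \<theta> * of_int (dot b c + dot a e)"
  by (cases a; cases b; cases c; cases e)
    (simp add: lift_def dot_def algebra_simps theta_theta_mult)

lemma lift_surj: "\<exists>a\<in>set cube. \<exists>b\<in>set cube. u = lift (a, b)"
proof -
  obtain u1 u2 u3 where u: "u = (u1, u2, u3)"
    by (cases u)
  obtain a1 b1 a2 b2 a3 b3 where
    "a1 \<in> set digits" "b1 \<in> set digits" "u1 = of_int a1 + \<theta> * of_int b1"
    "a2 \<in> set digits" "b2 \<in> set digits" "u2 = of_int a2 + \<theta> * of_int b2"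
    "a3 \<in> set digits" "b3 \<in> set digits" "u3 = of_int a3 + \<theta> * of_int b3"
    using expansion[of u1] expansion[of u2] expansion[of u3] by blast
  then have "(a1, a2, a3) \<in> set cube" "(b1, b2, b3) \<in> set cube" "u = lift ((a1, a2, a3), (b1, b2, b3))"
    by (auto simp: cube_def lift_def u)
  then show ?thesis by blast
qed

lemma inj_smul_lift:
  assumes "normal p"
  shows "inj (smul (lift p))"
  using assms by (cases p rule: normal.cases) (auto simp: inj_def smul_def lift_def)

lemma lift_normal_inj:
  assumes p: "normal p" and p': "normal p'"
    and eq: "range (smul (lift p)) = range (smul (lift p'))"
  shows "p = p'"
proof -
  have self: "v \<in> range (smul v)" for v :: "'a vec3"
    by (rule range_eqI[of _ _ 1]) (simp add: smul_def)
  obtain r where r: "lift p = smul (lift p') r"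
    using self[of "lift p"] eq by auto
  obtain r' where r': "lift p' = smul (lift p) r'"
    using self[of "lift p'"] eq by auto
  obtain x y z e f g where P: "p = ((x, y, z), (e, f, g))"
    by (cases p rule: normal.cases)
  obtain x' y' z' e' f' g' where P': "p' = ((x', y', z'), (e', f', g'))"
    by (cases p' rule: normal.cases)
  have not1: "\<theta> * s * t \<noteq> 1" "1 \<noteq> \<theta> * s * t" for s t
    using one_neq_theta_mult[of "s * t"] by (auto simp: mult.assoc)
  \<comment> \<open>At a common pivot the coordinates give \<open>1 = 1 * r\<close>; different
    pivots would make 1 a multiple of \<open>\<theta>\<close>.\<close>
  have "r = 1"
    using p p' r r' not1 unfolding P P' by (auto simp: lift_def smul_def)
  then have "lift p = lift p'"
    using r by (simp add: smul_def)
  then show ?thesis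
    using p p' expansion_unique[of x e x' e'] expansion_unique[of y f y' f']
      expansion_unique[of z g z' g']
    unfolding P P' by (simp add: lift_def)
qed

text \<open>
  The line spanned by \<open>x\<close> and \<open>y\<close> is annihilated by the cross product of \<open>x\<close> and \<open>y\<close>. If \<open>\<theta>\<close> killed the
  cross product, then \<open>\<theta>x\<^sub>i y - \<theta>y\<^sub>i x = 0\<close> for all \<open>i\<close>, so \<open>\<theta>x = 0\<close> by independence, which
  contradicts independence again.
\<close>

lemma line_annihilator:
  assumes "phg_line L"
  obtains a b where "a \<in> set cube" "a \<noteq> (0, 0, 0)" "b \<in> set cube"
    "\<forall>v\<in>L. dot (lift (a, b)) v = 0"
proof -
  obtain x y where L: "L = range (\<lambda>(s, t). vadd (smul x s) (smul y t))"
    and inj: "inj (\<lambda>(s, t). vadd (smul x s) (smul y t))"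
    using assms by (auto simp: phg_line_def)
  obtain x1 x2 x3 where x: "x = (x1, x2, x3)" by (cases x)
  obtain y1 y2 y3 where y: "y = (y1, y2, y3)" by (cases y)
  have indep: "s = 0 \<and> t = 0" if "vadd (smul x s) (smul y t) = (0, 0, 0)" for s t
    using injD[OF inj, of "(s, t)" "(0, 0)"] that by (simp add: vadd_def smul_def)
  define u where "u = (x2 * y3 - x3 * y2, x3 * y1 - x1 * y3, x1 * y2 - x2 * y1)"
  obtain a b where a: "a \<in> set cube" and b: "b \<in> set cube" and u_lift: "u = lift (a, b)"
    using lift_surj[of u] by blast
  have "a \<noteq> (0, 0, 0)"
  proof
    assume "a = (0, 0, 0)"
    then obtain k1 k2 k3 where k: "u = (\<theta> * k1, \<theta> * k2, \<theta> * k3)"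
      using u_lift by (cases b) (simp add: lift_def)
    have "\<theta> * (x2 * y3 - x3 * y2) = 0" "\<theta> * (x3 * y1 - x1 * y3) = 0" "\<theta> * (x1 * y2 - x2 * y1) = 0"
      using k by (simp_all add: u_def theta_theta_mult)
    then have
      "vadd (smul x (- (\<theta> * y1))) (smul y (\<theta> * x1)) = (0, 0, 0)"
      "vadd (smul x (- (\<theta> * y2))) (smul y (\<theta> * x2)) = (0, 0, 0)"
      "vadd (smul x (- (\<theta> * y3))) (smul y (\<theta> * x3)) = (0, 0, 0)"
      by (simp_all add: vadd_def smul_def x y algebra_simps)
    then have "\<theta> * x1 = 0" "\<theta> * x2 = 0" "\<theta> * x3 = 0"
      using indep by blast+
    then have "vadd (smul x \<theta>) (smul y 0) = (0, 0, 0)"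
      by (simp add: vadd_def smul_def x mult.commute)
    then show False
      using indep theta_nonzero by blast
  qed
  moreover have "dot (lift (a, b)) v = 0" if "v \<in> L" for v
    using that unfolding L u_lift[symmetric]
    by (auto simp: u_def dot_def vadd_def smul_def x y algebra_simps)
  ultimately show ?thesis
    using that a b by blast
qed

lemma certificate_arc:
  assumes cert: "arc_certificate n Cs"
  shows "proj_arc ((\<lambda>p. range (smul (lift p))) ` set (points Cs)) (length (points Cs)) n"
proof -
  let ?P = "\<lambda>p. range (smul (lift p))"
  have normal: "normal p" if "p \<in> set (points Cs)" for p
    using cert that unfolding arc_certificate_def list_all_iff by blast
  have distinct: "distinct (points Cs)"
    using cert unfolding arc_certificate_def by (blast intro: distinct_points)
  have "inj_on ?P (set (points Cs))"
    by (rule inj_onI) (rule lift_normal_inj; simp add: normal)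
  then have card: "card (?P ` set (points Cs)) = length (points Cs)"
    by (simp add: card_image distinct_card distinct)
  have line: "card {P \<in> ?P ` set (points Cs). P \<subseteq> L} \<le> n" if "phg_line L" for L
  proof -
    obtain a b where ab: "a \<in> set cube" "a \<noteq> (0, 0, 0)" "b \<in> set cube"
      and ann: "\<forall>v\<in>L. dot (lift (a, b)) v = 0"
      using line_annihilator[OF \<open>phg_line L\<close>] by blast
    let ?Q = "\<lambda>(c, e). 5 dvd dot a c \<and> 5 dvd (\<epsilon> * (dot a c div 5) + dot b c) + dot a e"
    have "?Q (c, e)" if "?P (c, e) \<subseteq> L" for c e
    proof -
      have "lift (c, e) \<in> ?P (c, e)"
        by (rule range_eqI[of _ _ 1]) (simp add: smul_def)
      then have "of_int (dot a c) + \<theta> * of_int (dot b c + dot a e) = 0"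
        using that ann by (metis dot_lift subsetD)
      from of_int_theta_eq_0D[OF this] show ?thesis
        by (simp add: add.assoc)
    qed
    then have "{P \<in> ?P ` set (points Cs). P \<subseteq> L} \<subseteq> ?P ` set (filter ?Q (points Cs))"
      by force
    then have "card {P \<in> ?P ` set (points Cs). P \<subseteq> L} \<le> card (set (filter ?Q (points Cs)))"
      by (meson List.finite_set card_image_le card_mono finite_imageI order_trans)
    also have "\<dots> \<le> length (filter ?Q (points Cs))"
      by (rule card_length)
    also have "\<dots> \<le> n"
      using cert ab by (rule certificate_bound)
    finally show ?thesis .
  qed
  have "phg_point (?P p)" if "p \<in> set (points Cs)" for p
    using inj_smul_lift[OF normal[OF that]] unfolding phg_point_def by blast
  then show ?thesis
    by (auto simp: proj_arc_def card line)
qed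

end

section \<open>The rings Z_25 and S_5\<close>

lemma chain_ring_Z25: "chain_ring_5 (5 :: Z25) 1"
proof
  fix r :: Z25
  obtain z where z: "r = of_int z" "0 \<le> z" "z < 25"
    by (cases r) auto
  have "z mod 5 \<in> set digits" "z div 5 \<in> set digits"
    using z mod_5_in_digits[of z] mod_5_in_digits[of "z div 5"]
    by (auto simp: mod_pos_pos_trivial div_less_iff_less_mult)
  moreover have "r = of_int (z mod 5) + 5 * of_int (z div 5)"
  proof -
    have "r = of_int (z mod 5 + 5 * (z div 5))"
      by (simp add: z)
    then show ?thesis
      by (simp only: of_int_add of_int_mult of_int_numeral)
  qed
  ultimately show "\<exists>a\<in>set digits. \<exists>b\<in>set digits. r = of_int a + 5 * of_int b"
    by blast
next
  fix k :: int
  assume "(5 :: Z25) * of_int k = 0"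
  then have "(of_int (5 * k) :: Z25) = 0"
    by simp
  then have "25 dvd 5 * k"
    by (subst (asm) of_int_eq_0_iff_char_dvd) simp
  then show "5 dvd k" by presburger
qed simp_all

lemma of_int_dual: "(of_int k :: 'a::comm_ring_1 dual) = Dual (of_int k) 0"
  by (induction k rule: int_induct[where k = 0])
    (simp_all add: zero_dual_def one_dual_def plus_dual_def minus_dual_def)

lemma chain_ring_S5: "chain_ring_5 (Dual 0 1 :: S5) 0"
proof
  fix r :: S5
  obtain s t where r: "r = Dual s t"
    by (cases r)
  obtain a b where "s = of_int a" "0 \<le> a" "a < 5" "t = of_int b" "0 \<le> b" "b < 5"
    by (cases s, cases t) auto
  moreover from this have "a \<in> set digits" "b \<in> set digits"
    using mod_5_in_digits[of a] mod_5_in_digits[of b] by (simp_all add: mod_pos_pos_trivial)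
  ultimately show "\<exists>a\<in>set digits. \<exists>b\<in>set digits. r = of_int a + Dual 0 1 * of_int b"
    by (intro bexI[of _ a] bexI[of _ b]) (simp_all add: r of_int_dual plus_dual_def times_dual_def)
next
  fix k :: int
  assume "(Dual 0 1 :: S5) * of_int k = 0"
  then have "(of_int k :: 5) = 0"
    by (simp add: of_int_dual times_dual_def zero_dual_def)
  then show "5 dvd k"
    by (subst (asm) of_int_eq_0_iff_char_dvd) simp
next
  have "(5 :: S5) = of_int 5"
    by simp
  also have "\<dots> = 0"
    unfolding of_int_dual by (simp add: zero_dual_def)
  finally show "(5 :: S5) = Dual 0 1 * of_int 0"
    by simp
qed (simp add: times_dual_def zero_dual_def)

section \<open>The arcs\<close>

text \<open>
  The directions are chosen from \<open>1 + 1 + 3 = 0\<close> in \<open>F\<^sub>5\<close>: since \<open>a\<^sup>3\<close> is the inverse of \<open>a\<close>, the line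
  \<open>(1, a\<^sup>3, 3 b\<^sup>3)\<close> contains \<open>(1, a, b)\<close>.
\<close>

definition inner_cells :: "cell list" where
  "inner_cells =
    [((1, a, b), (1, a ^ 3, 3 * b ^ 3), [0, 1, 2, 3]). a \<leftarrow> [1, 2, 3, 4], b \<leftarrow> [1, 2, 3, 4]]"

text \<open>
  Together with \<open>(0, 0)\<close>, the pairs \<open>(t, w)\<close> with \<open>w\<close> in the list of \<open>t\<close> form a (9,3)-arc;
  so they do with the point at infinity of the horizontal lines.
\<close>

definition side_offsets :: "(int \<times> int list) list" where
  "side_offsets = [(1, [0, 1]), (2, [0, 3]), (3, [1, 2]), (4, [2, 3])]"

definition cells19 :: "cell list" where
  "cells19 = inner_cells
     @ [((1, t, 0), (0, 0, 1), W). (t, W) \<leftarrow> side_offsets]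
     @ [((1, 0, t), (0, 1, 0), W). (t, W) \<leftarrow> side_offsets]
     @ [((0, 1, t), (1, 0, 0), W). (t, W) \<leftarrow> side_offsets]
     @ [((1, 0, 0), (0, 0, 1), [0]), ((0, 1, 0), (1, 0, 0), [0]), ((0, 0, 1), (0, 1, 0), [0])]"

definition cells18 :: "cell list" where
  "cells18 = inner_cells
     @ [((1, t, 0), (0, 0, 1), W). (t, W) \<leftarrow> side_offsets]
     @ [((1, 0, t), (0, 1, 0), W). (t, W) \<leftarrow> side_offsets]
     @ [((0, 1, t), (1, 0, 0), [hd W]). (t, W) \<leftarrow> side_offsets]
     @ [((1, 0, 0), (0, 0, 1), [0])]"

lemma length_points: "length (points cells18) = 425" "length (points cells19) = 455"
  by code_simp+

lemma certificate18: "arc_certificate 18 cells18"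
  by code_simp

lemma certificate19: "arc_certificate 19 cells19"
  by code_simp

theorem theorem3p10:
  shows "(\<exists>K :: Z25 vec3 set set. proj_arc K 425 18) \<and>
         (\<exists>K :: Z25 vec3 set set. proj_arc K 455 19) \<and>
         (\<exists>K :: S5 vec3 set set. proj_arc K 425 18) \<and>
         (\<exists>K :: S5 vec3 set set. proj_arc K 455 19)"
  using chain_ring_5.certificate_arc[OF chain_ring_Z25 certificate18]
    chain_ring_5.certificate_arc[OF chain_ring_Z25 certificate19]
    chain_ring_5.certificate_arc[OF chain_ring_S5 certificate18]
    chain_ring_5.certificate_arc[OF chain_ring_S5 certificate19]
  unfolding length_points by blast

end
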